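(* Let $A\in\mathbb{R}^{n\times n}$ be Hurwitz (all eigenvalues with strictly negative real parts), let $C\in\mathbb{R}^{r\times n}$ be such that $(A,C)$ is observable, and let $P$ be the unique symmetric positive definite solution of $A^TP+PA+C^TC=0$. Let $Q\in\mathbb{R}^{n\times m}$ satisfy $Q^TQ=I_{m\times m}$. Then for every initial state $y(0)\in\mathbb{R}^n$, the solution $y(t)$ of $\dot y=Ay$ satisfies, for all $t\ge 0$, $$Q^Ty(t)\in\mathcal{E}\big(0,\ Q^TP^{-1}Q,\ \|y(0)\|_P\big).$$
   Context: $\|y\|_P=\sqrt{y^TPy}$. For $c\in\mathbb{R}^m$, a symmetric positive semidefinite $\Sigma\in\mathbb{R}^{m\times m}$ and $\rho\ge 0$, $\mathcal{E}(c,\Sigma,\rho)=\{c+\Sigma^{1/2}u: u\in\mathbb{R}^m,\ \|u\|\le\rho\}$ with $\Sigma^{1/2}$ the symmetric positive semidefinite square root. *)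

theory Defs
  imports "HOL-Analysis.Analysis"
begin

text \<open>Complexification of a real square matrix (to speak about its complex eigenvalues).\<close>
definition cmat :: "real^'n^'m \<Rightarrow> complex^'n^'m" where
  "cmat A = (\<chi> i j. complex_of_real (A $ i $ j))"

text \<open>Hurwitz: every (complex) eigenvalue has strictly negative real part.\<close>
definition hurwitz :: "real^'n^'n \<Rightarrow> bool" where
  "hurwitz A \<longleftrightarrow>
     (\<forall>(lam::complex) (v::complex^'n). v \<noteq> 0 \<and> cmat A *v v = lam *s v \<longrightarrow> Re lam < 0)"

text \<open>Observability of (A,C): the observability matrix [C; CA; ...; CA^(n-1)] has full
  column rank n, i.e. its kernel is trivial.\<close>
definition observable :: "real^'n^'n \<Rightarrow> real^'n^'r \<Rightarrow> bool" where
  "observable A C \<longleftrightarrow>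
     (\<forall>x::real^'n. (\<forall>k<CARD('n). C *v (((*v) A ^^ k) x) = 0) \<longrightarrow> x = 0)"

definition sym_mat :: "real^'n^'n \<Rightarrow> bool" where
  "sym_mat S \<longleftrightarrow> transpose S = S"

definition psd_mat :: "real^'n^'n \<Rightarrow> bool" where
  "psd_mat S \<longleftrightarrow> sym_mat S \<and> (\<forall>x. 0 \<le> x \<bullet> (S *v x))"

definition pd_mat :: "real^'n^'n \<Rightarrow> bool" where
  "pd_mat S \<longleftrightarrow> sym_mat S \<and> (\<forall>x. x \<noteq> 0 \<longrightarrow> 0 < x \<bullet> (S *v x))"

text \<open>The symmetric positive semidefinite square root.\<close>
definition mat_sqrt :: "real^'n^'n \<Rightarrow> real^'n^'n" where
  "mat_sqrt S = (THE R. psd_mat R \<and> R ** R = S)"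

text \<open>Weighted norm \<open>\<parallel>y\<parallel>_P = sqrt (y^T P y)\<close>.\<close>
definition wnorm :: "real^'n^'n \<Rightarrow> real^'n \<Rightarrow> real" where
  "wnorm P y = sqrt (y \<bullet> (P *v y))"

text \<open>Ellipsoid E(c, Sigma, rho) = {c + Sigma^(1/2) u : norm u \<le> rho}.\<close>
definition ellipsoid :: "real^'m \<Rightarrow> real^'m^'m \<Rightarrow> real \<Rightarrow> (real^'m) set" where
  "ellipsoid c S rho = {c + mat_sqrt S *v u | u. norm u \<le> rho}"

end

theory Submission
  imports Defs
begin

text \<open>Along a trajectory the Lyapunov function \<open>V = y^T P y\<close> is nonincreasing, since the
  Lyapunov equation gives \<open>V' = -|C y|^2\<close>. With \<open>z = Q^T y\<close> and \<open>S = Q^T P^-1 Q\<close>,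
  Cauchy-Schwarz for the inner product defined by \<open>P\<close> gives \<open>z^T S^-1 z \<le> y^T P y\<close>, so
  \<open>u = S^1/2 S^-1 z\<close> satisfies \<open>S^1/2 u = z\<close> and \<open>|u|^2 = z^T S^-1 z \<le> V(0)\<close>.
  As \<open>S^1/2\<close> is a definite description, existence and uniqueness of positive semidefinite
  square roots have to be proved as well; both rest on eigenvectors obtained by maximising the
  quadratic form over the unit sphere. Stability of \<open>A\<close> and observability only serve to
  make \<open>P\<close> exist.\<close>

lemma inner_vector_matrix: "(x::real^'n) \<bullet> (y v* A) = (A *v x) \<bullet> y"
  by (metis dot_lmul_matrix inner_commute)

lemma sym_mat_inner_commute:
  "sym_mat S \<Longrightarrow> (x::real^'n) \<bullet> (S *v y) = (S *v x) \<bullet> y"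
  by (metis dot_lmul_matrix sym_mat_def transpose_matrix_vector)

lemma sym_mat_add: "sym_mat A \<Longrightarrow> sym_mat B \<Longrightarrow> sym_mat (A + B)"
  by (simp add: sym_mat_def transpose_def vec_eq_iff)

lemma sym_mat_diff: "sym_mat A \<Longrightarrow> sym_mat B \<Longrightarrow> sym_mat (A - B)"
  by (simp add: sym_mat_def transpose_def vec_eq_iff)

lemma pd_imp_psd_mat: "pd_mat S \<Longrightarrow> psd_mat S"
  unfolding pd_mat_def psd_mat_def by (metis inner_zero_left order_le_less)

lemma quadratic_form_scaleR:
  "(c *\<^sub>R x) \<bullet> (S *v (c *\<^sub>R x)) = c\<^sup>2 * (x \<bullet> (S *v (x::real^'n)))"
  by (simp add: matrix_vector_mult_scaleR power2_eq_square)

lemma sym_mat_quadratic_form_add: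
  assumes "sym_mat S"
  shows "(x + t *\<^sub>R y) \<bullet> (S *v (x + t *\<^sub>R y)) =
           x \<bullet> (S *v x) + 2 * t * (x \<bullet> (S *v y)) + t\<^sup>2 * (y \<bullet> (S *v (y::real^'n)))"
  using sym_mat_inner_commute[OF assms, of y x]
  by (simp add: inner_add_left inner_add_right inner_commute algebra_simps power2_eq_square)

lemma nonneg_quadratic_discriminant:
  fixes a b c :: real
  assumes "0 \<le> c" and nonneg: "\<And>t. 0 \<le> a + 2 * t * b + t\<^sup>2 * c"
  shows "b\<^sup>2 \<le> a * c"
proof (cases "c = 0")
  case True
  have "b = 0"
  proof (rule ccontr)
    assume "b \<noteq> 0"
    define t where "t = - (\<bar>a\<bar> + 1) / (2 * b)"
    have "2 * t * b = - (\<bar>a\<bar> + 1)" using \<open>b \<noteq> 0\<close> by (simp add: t_def)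
    moreover have "0 \<le> a + 2 * t * b + t\<^sup>2 * c" by (rule nonneg)
    ultimately show False using True abs_ge_self[of a] by simp
  qed
  with True show ?thesis by simp
next
  case False
  with assms(1) have "0 < c" by simp
  have "0 \<le> a + 2 * (- b / c) * b + (- b / c)\<^sup>2 * c" by (rule nonneg)
  also have "\<dots> = a - b\<^sup>2 / c" using \<open>0 < c\<close> by (simp add: field_simps power2_eq_square)
  finally show ?thesis using \<open>0 < c\<close> by (simp add: field_simps)
qed

lemma psd_mat_Cauchy_Schwarz:
  assumes "psd_mat S"
  shows "(x \<bullet> (S *v y))\<^sup>2 \<le> (x \<bullet> (S *v x)) * (y \<bullet> (S *v (y::real^'n)))"
  using assms unfolding psd_mat_def
  by (intro nonneg_quadratic_discriminant) (auto simp flip: sym_mat_quadratic_form_add)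

lemma psd_mat_quadratic_form_eq_0:
  assumes "psd_mat S" and "x \<bullet> (S *v x) = 0"
  shows "S *v x = 0"
proof -
  have "(x \<bullet> (S *v (S *v x)))\<^sup>2 \<le> 0"
    using psd_mat_Cauchy_Schwarz[OF assms(1), of x "S *v x"] assms(2) by simp
  moreover have "x \<bullet> (S *v (S *v x)) = (S *v x) \<bullet> (S *v x)"
    using assms(1) sym_mat_inner_commute unfolding psd_mat_def by blast
  ultimately show ?thesis by simp
qed

lemma sym_mat_eq_0_if_quadratic_form_eq_0:
  fixes S :: "real^'n^'n"
  assumes "sym_mat S" and "\<And>x. x \<bullet> (S *v x) = 0"
  shows "S = 0"
proof -
  have "psd_mat S" using assms by (simp add: psd_mat_def)
  with assms(2) have "S *v x = 0" for x by (simp add: psd_mat_quadratic_form_eq_0)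
  then show ?thesis by (metis matrix_eq matrix_vector_mult_0)
qed

text \<open>The maximiser of the quadratic form on the unit sphere is an eigenvector: at the
  maximum \<open>lam\<close>, the matrix \<open>lam I - S\<close> is positive semidefinite and its form vanishes there.\<close>
lemma sym_mat_top_eigenvector:
  fixes S :: "real^'n^'n"
  assumes "sym_mat S"
  obtains v lam where "norm v = 1" and "S *v v = lam *\<^sub>R v"
    and "\<And>x. x \<bullet> (S *v x) \<le> lam * (norm x)\<^sup>2"
proof -
  have "continuous_on (sphere 0 1) (\<lambda>x. x \<bullet> (S *v x))"
    by (intro continuous_intros linear_continuous_on matrix_vector_mul_bounded_linear)
  moreover have "sphere (0::real^'n) 1 \<noteq> {}" by simp
  ultimately obtain v where "v \<in> sphere 0 1"
    and "\<forall>u \<in> sphere 0 1. u \<bullet> (S *v u) \<le> v \<bullet> (S *v v)"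
    using continuous_attains_sup[OF compact_sphere] by blast
  then have v: "norm v = 1" and vmax: "\<And>u. norm u = 1 \<Longrightarrow> u \<bullet> (S *v u) \<le> v \<bullet> (S *v v)"
    by simp_all
  define lam where "lam = v \<bullet> (S *v v)"
  have bound: "x \<bullet> (S *v x) \<le> lam * (norm x)\<^sup>2" for x
  proof (cases "x = 0")
    case False
    define u where "u = x /\<^sub>R norm x"
    have "x = norm x *\<^sub>R u" using False by (simp add: u_def)
    then have "x \<bullet> (S *v x) = (norm x)\<^sup>2 * (u \<bullet> (S *v u))" by (metis quadratic_form_scaleR)
    moreover have "u \<bullet> (S *v u) \<le> lam"
      unfolding lam_def using False by (intro vmax) (simp add: u_def)
    ultimately show ?thesis by (metis mult.commute mult_right_mono zero_le_power2)
  qed simp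
  define M where "M = lam *\<^sub>R mat 1 - S"
  have Mx: "M *v x = lam *\<^sub>R x - S *v x" for x
    by (simp add: M_def matrix_vector_mult_diff_rdistrib flip: scaleR_matrix_vector_assoc)
  have "psd_mat M"
  proof -
    have "sym_mat M" using assms by (simp add: M_def sym_mat_def transpose_def vec_eq_iff mat_def)
    moreover have "0 \<le> x \<bullet> (M *v x)" for x
      using bound[of x] by (simp add: Mx inner_diff_right power2_norm_eq_inner)
    ultimately show ?thesis by (simp add: psd_mat_def)
  qed
  moreover have "v \<bullet> (M *v v) = 0"
    using v by (simp add: Mx inner_diff_right lam_def power2_norm_eq_inner[symmetric])
  ultimately have "M *v v = 0" by (rule psd_mat_quadratic_form_eq_0)
  then have "S *v v = lam *\<^sub>R v" by (simp add: Mx)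
  from v this bound show ?thesis by (rule that)
qed

text \<open>Since \<open>|R1 v| = |R2 v|\<close>, an eigenvalue \<open>lam\<close> of \<open>R1 - R2\<close> with eigenvector \<open>v\<close>
  satisfies \<open>lam (v^T R1 v + v^T R2 v) = 0\<close>.\<close>
lemma psd_mat_sqrt_diff_eigenvalue_eq_0:
  fixes R1 R2 :: "real^'n^'n"
  assumes p1: "psd_mat R1" and p2: "psd_mat R2" and sq: "R1 ** R1 = R2 ** R2"
    and v: "norm v = 1" and ev: "(R1 - R2) *v v = lam *\<^sub>R v"
  shows "lam = 0"
proof (rule ccontr)
  assume "lam \<noteq> 0"
  define a1 a2 where "a1 = R1 *v v" and "a2 = R2 *v v"
  have vv: "v \<bullet> v = 1" using v by (simp add: norm_eq_1)
  have a12: "a1 = a2 + lam *\<^sub>R v"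
    using ev by (simp add: a1_def a2_def matrix_vector_mult_diff_rdistrib algebra_simps)
  have "a1 \<bullet> a1 = v \<bullet> ((R1 ** R1) *v v)"
    using p1 sym_mat_inner_commute[of R1 v a1]
    by (simp add: psd_mat_def a1_def matrix_vector_mul_assoc)
  moreover have "a2 \<bullet> a2 = v \<bullet> ((R2 ** R2) *v v)"
    using p2 sym_mat_inner_commute[of R2 v a2]
    by (simp add: psd_mat_def a2_def matrix_vector_mul_assoc)
  ultimately have "a1 \<bullet> a1 = a2 \<bullet> a2" using sq by simp
  then have "lam * (v \<bullet> a1 + v \<bullet> a2) = 0"
    using a12 vv
    by (simp add: inner_add_left inner_add_right inner_commute algebra_simps power2_eq_square)
  with \<open>lam \<noteq> 0\<close> have "v \<bullet> a1 + v \<bullet> a2 = 0" by simp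
  moreover have "0 \<le> v \<bullet> a1" "0 \<le> v \<bullet> a2"
    using p1 p2 by (auto simp: psd_mat_def a1_def a2_def)
  ultimately have "a1 = 0" "a2 = 0"
    using psd_mat_quadratic_form_eq_0[OF p1] psd_mat_quadratic_form_eq_0[OF p2]
    by (auto simp: a1_def a2_def)
  with a12 \<open>lam \<noteq> 0\<close> v show False by auto
qed

lemma psd_mat_sqrt_unique:
  fixes R1 R2 :: "real^'n^'n"
  assumes "psd_mat R1" and "psd_mat R2" and "R1 ** R1 = R2 ** R2"
  shows "R1 = R2"
proof -
  have form_le: "x \<bullet> ((R - R') *v x) \<le> 0"
    if "psd_mat R" "psd_mat R'" "R ** R = R' ** R'" for R R' :: "real^'n^'n" and x
  proof -
    have "sym_mat (R - R')" using that by (simp add: psd_mat_def sym_mat_diff)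
    then obtain v lam where "norm v = 1" "(R - R') *v v = lam *\<^sub>R v"
      and top: "\<And>x. x \<bullet> ((R - R') *v x) \<le> lam * (norm x)\<^sup>2"
      using sym_mat_top_eigenvector by blast
    then have "lam = 0" by (intro psd_mat_sqrt_diff_eigenvalue_eq_0[OF that])
    with top[of x] show ?thesis by simp
  qed
  have "x \<bullet> ((R1 - R2) *v x) = 0" for x
    using form_le[OF assms, of x] form_le[OF assms(2,1) assms(3)[symmetric], of x]
    by (simp add: matrix_vector_mult_diff_rdistrib inner_diff_right)
  with assms have "R1 - R2 = 0"
    by (intro sym_mat_eq_0_if_quadratic_form_eq_0 sym_mat_diff) (auto simp: psd_mat_def)
  then show ?thesis by simp
qed

definition outer :: "real^'n \<Rightarrow> real^'n^'n" where
  "outer v = (\<chi> i j. v $ i * v $ j)"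

lemma outer_mult_vector: "outer v *v x = (v \<bullet> x) *\<^sub>R v"
  by (simp add: vec_eq_iff outer_def matrix_vector_mult_def inner_vec_def sum_distrib_left
      algebra_simps)

lemma sym_mat_scaleR_outer: "sym_mat (c *\<^sub>R outer v)"
  by (simp add: sym_mat_def transpose_def outer_def vec_eq_iff mult.commute)

lemma diff_outer_mult_vector:
  "(S - lam *\<^sub>R outer v) *v x = S *v x - (lam * (v \<bullet> x)) *\<^sub>R v"
  by (simp add: matrix_vector_mult_diff_rdistrib outer_mult_vector flip: scaleR_matrix_vector_assoc)

lemma psd_mat_deflate:
  fixes S :: "real^'n^'n"
  assumes psd: "psd_mat S" and v: "norm v = 1" and ev: "S *v v = lam *\<^sub>R v"
  shows "psd_mat (S - lam *\<^sub>R outer v)"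
proof -
  have sym_S: "sym_mat S" using psd by (simp add: psd_mat_def)
  have "0 \<le> x \<bullet> ((S - lam *\<^sub>R outer v) *v x)" for x
  proof -
    define c w where "c = v \<bullet> x" and "w = x - c *\<^sub>R v"
    have vv: "v \<bullet> v = 1" using v by (simp add: norm_eq_1)
    then have "w \<bullet> v = 0" by (simp add: w_def c_def inner_diff_left inner_commute[of x v])
    then have "w \<bullet> (S *v v) = 0" by (simp add: ev)
    have "x = w + c *\<^sub>R v" by (simp add: w_def)
    then have "x \<bullet> (S *v x) = w \<bullet> (S *v w) + 2 * c * (w \<bullet> (S *v v)) + c\<^sup>2 * (v \<bullet> (S *v v))"
      by (simp only: sym_mat_quadratic_form_add[OF sym_S])
    also have "\<dots> = w \<bullet> (S *v w) + c\<^sup>2 * lam"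
      using \<open>w \<bullet> (S *v v) = 0\<close> ev vv by simp
    finally have "x \<bullet> (S *v x) = w \<bullet> (S *v w) + c\<^sup>2 * lam" .
    moreover have "x \<bullet> ((S - lam *\<^sub>R outer v) *v x) = x \<bullet> (S *v x) - c\<^sup>2 * lam"
      by (simp add: c_def diff_outer_mult_vector inner_diff_right inner_commute power2_eq_square)
    moreover have "0 \<le> w \<bullet> (S *v w)" using psd by (simp add: psd_mat_def)
    ultimately show ?thesis by simp
  qed
  with sym_S show ?thesis by (simp add: psd_mat_def sym_mat_diff sym_mat_scaleR_outer)
qed

lemma psd_mat_add_sqrt_outer:
  fixes R :: "real^'n^'n"
  assumes psd: "psd_mat R" and Rv: "R *v v = 0" and v: "norm v = 1" and "0 \<le> lam"
  shows "psd_mat (R + sqrt lam *\<^sub>R outer v)"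
    and "(R + sqrt lam *\<^sub>R outer v) ** (R + sqrt lam *\<^sub>R outer v) = R ** R + lam *\<^sub>R outer v"
proof -
  have sym_R: "sym_mat R" using psd by (simp add: psd_mat_def)
  have Rx: "(R + sqrt lam *\<^sub>R outer v) *v x = R *v x + (sqrt lam * (v \<bullet> x)) *\<^sub>R v" for x
    by (simp add: matrix_vector_mult_add_rdistrib outer_mult_vector flip: scaleR_matrix_vector_assoc)
  have "x \<bullet> ((R + sqrt lam *\<^sub>R outer v) *v x) = x \<bullet> (R *v x) + sqrt lam * (v \<bullet> x)\<^sup>2" for x
    by (simp add: Rx inner_add_right inner_commute power2_eq_square)
  then have "0 \<le> x \<bullet> ((R + sqrt lam *\<^sub>R outer v) *v x)" for x
    using psd \<open>0 \<le> lam\<close> by (simp add: psd_mat_def)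
  then show "psd_mat (R + sqrt lam *\<^sub>R outer v)"
    using sym_R by (simp add: psd_mat_def sym_mat_add sym_mat_scaleR_outer)
  have "v \<bullet> (R *v x) = 0" for x using sym_mat_inner_commute[OF sym_R, of v x] Rv by simp
  then show "(R + sqrt lam *\<^sub>R outer v) ** (R + sqrt lam *\<^sub>R outer v) = R ** R + lam *\<^sub>R outer v"
    using Rv v \<open>0 \<le> lam\<close>
    by (simp add: matrix_eq Rx matrix_vector_mult_add_rdistrib inner_add_right norm_eq_1
        outer_mult_vector algebra_simps flip: matrix_vector_mul_assoc scaleR_matrix_vector_assoc)
qed

lemma dim_kernel_less_deflate:
  fixes S :: "real^'n^'n"
  assumes "sym_mat S" and "norm v = 1" and ev: "S *v v = lam *\<^sub>R v" and "lam \<noteq> 0"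
  shows "dim {x. S *v x = 0} < dim {x. (S - lam *\<^sub>R outer v) *v x = 0}"
proof -
  have "{x. S *v x = 0} \<subset> {x. (S - lam *\<^sub>R outer v) *v x = 0}"
  proof
    show "{x. S *v x = 0} \<subseteq> {x. (S - lam *\<^sub>R outer v) *v x = 0}"
    proof clarify
      fix x assume "S *v x = 0"
      moreover have "v \<bullet> (S *v x) = lam * (v \<bullet> x)"
        using sym_mat_inner_commute[OF assms(1), of v x] ev by simp
      ultimately show "(S - lam *\<^sub>R outer v) *v x = 0" by (simp add: diff_outer_mult_vector)
    qed
    have "(S - lam *\<^sub>R outer v) *v v = 0" and "S *v v \<noteq> 0"
      using assms by (auto simp: diff_outer_mult_vector norm_eq_1)
    then show "{x. S *v x = 0} \<noteq> {x. (S - lam *\<^sub>R outer v) *v x = 0}" by blast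
  qed
  then show ?thesis
    by (intro dim_psubset)
      (simp add: span_eq_iff[THEN iffD2] linear_subspace_kernel[OF matrix_vector_mul_linear])
qed

text \<open>Induction on the codimension of the kernel: splitting off the top eigenvalue
  \<open>lam > 0\<close> with eigenvector \<open>v\<close> leaves a positive semidefinite matrix that also kills \<open>v\<close>.\<close>
lemma psd_mat_sqrt_exists:
  fixes S :: "real^'n^'n"
  assumes "psd_mat S"
  shows "\<exists>R. psd_mat R \<and> R ** R = S"
  using assms
proof (induction "CARD('n) - dim {x. S *v x = 0}" arbitrary: S rule: less_induct)
  case less
  show ?case
  proof (cases "S = 0")
    case True
    then show ?thesis
      by (intro exI[of _ 0]) (simp add: psd_mat_def sym_mat_def transpose_def vec_eq_iff)
  next
    case False
    have sym_S: "sym_mat S" using less.prems by (simp add: psd_mat_def)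
    obtain v lam where v: "norm v = 1" and ev: "S *v v = lam *\<^sub>R v"
      and top: "\<And>x. x \<bullet> (S *v x) \<le> lam * (norm x)\<^sup>2"
      using sym_mat_top_eigenvector[OF sym_S] by blast
    have "0 \<le> lam"
      using less.prems ev v by (metis psd_mat_def inner_scaleR_right norm_eq_1 mult_1_right)
    moreover have "lam \<noteq> 0"
    proof
      assume "lam = 0"
      then have "x \<bullet> (S *v x) = 0" for x
        using top[of x] less.prems by (simp add: order_antisym psd_mat_def)
      with sym_S False show False by (metis sym_mat_eq_0_if_quadratic_form_eq_0)
    qed
    ultimately have "0 < lam" by simp
    define S' where "S' = S - lam *\<^sub>R outer v"
    have "dim {x. S *v x = 0} < dim {x. S' *v x = 0}"
      unfolding S'_def using sym_S v ev \<open>lam \<noteq> 0\<close> by (rule dim_kernel_less_deflate)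
    moreover have "dim {x. S' *v x = 0} \<le> CARD('n)"
      using dim_subset_UNIV[of "{x. S' *v x = 0}"] by simp
    moreover have "psd_mat S'" unfolding S'_def using less.prems v ev by (rule psd_mat_deflate)
    ultimately obtain R' where psd_R': "psd_mat R'" and R'R': "R' ** R' = S'"
      using less.hyps[of S'] by (meson diff_less_mono2 order.strict_trans2)
    have "(R' *v v) \<bullet> (R' *v v) = v \<bullet> (S' *v v)"
      using psd_R' sym_mat_inner_commute[of R' v "R' *v v"]
      by (simp add: psd_mat_def matrix_vector_mul_assoc R'R')
    also have "\<dots> = 0" using ev v by (simp add: S'_def diff_outer_mult_vector norm_eq_1)
    finally have "R' *v v = 0" by simp
    with psd_R' v \<open>0 < lam\<close> show ?thesis
      using psd_mat_add_sqrt_outer[of R' v lam] by (auto simp: R'R' S'_def)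
  qed
qed

lemma psd_mat_sqrt:
  assumes "psd_mat S"
  shows "psd_mat (mat_sqrt S)" and "mat_sqrt S ** mat_sqrt S = S"
proof -
  have "\<exists>!R. psd_mat R \<and> R ** R = S"
    using psd_mat_sqrt_exists[OF assms] psd_mat_sqrt_unique by metis
  from theI'[OF this] show "psd_mat (mat_sqrt S)" "mat_sqrt S ** mat_sqrt S = S"
    unfolding mat_sqrt_def by auto
qed

lemma matrix_inv_inverse:
  fixes A :: "real^'n^'n"
  assumes "invertible A"
  shows "A ** matrix_inv A = mat 1" and "matrix_inv A ** A = mat 1"
  using someI_ex[OF assms[unfolded invertible_def]] by (auto simp: matrix_inv_def)

lemma pd_mat_invertible:
  fixes P :: "real^'n^'n"
  assumes "pd_mat P"
  shows "invertible P"
proof -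
  have "P *v x = 0 \<Longrightarrow> x = 0" for x
    using assms unfolding pd_mat_def by force
  then show ?thesis by (simp add: invertible_left_inverse matrix_left_invertible_ker)
qed

lemma pd_mat_matrix_inv:
  fixes P :: "real^'n^'n"
  assumes pd: "pd_mat P"
  shows "pd_mat (matrix_inv P)"
proof -
  define P' where "P' = matrix_inv P"
  have PP': "P ** P' = mat 1"
    using matrix_inv_inverse[OF pd_mat_invertible[OF pd]] by (simp add: P'_def)
  have sym_P: "sym_mat P" using pd by (simp add: pd_mat_def)
  have "transpose P' = transpose P' ** (P ** P')" by (simp add: PP')
  also have "\<dots> = transpose (P ** P') ** P'"
    using sym_P by (simp add: matrix_mul_assoc matrix_transpose_mul sym_mat_def)
  finally have "sym_mat P'" by (simp add: PP' sym_mat_def)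
  moreover have "0 < x \<bullet> (P' *v x)" if "x \<noteq> 0" for x
  proof -
    have "P *v (P' *v x) = x" by (simp add: matrix_vector_mul_assoc PP')
    with that have "P' *v x \<noteq> 0" by auto
    with pd have "0 < (P' *v x) \<bullet> (P *v (P' *v x))" by (simp add: pd_mat_def)
    with \<open>P *v (P' *v x) = x\<close> show ?thesis by (simp add: inner_commute)
  qed
  ultimately show ?thesis by (simp add: pd_mat_def P'_def)
qed

lemma pd_mat_congruence:
  fixes P :: "real^'n^'n" and Q :: "real^'m^'n"
  assumes pd: "pd_mat P" and inj: "\<And>x. Q *v x = 0 \<Longrightarrow> x = 0"
  shows "pd_mat (transpose Q ** P ** Q)"
proof -
  have form: "x \<bullet> ((transpose Q ** P ** Q) *v x) = (Q *v x) \<bullet> (P *v (Q *v x))" for x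
    by (simp add: inner_vector_matrix flip: matrix_vector_mul_assoc)
  have "sym_mat (transpose Q ** P ** Q)"
    using pd by (simp add: pd_mat_def sym_mat_def matrix_transpose_mul matrix_mul_assoc)
  with pd inj show ?thesis by (auto simp: pd_mat_def form)
qed

text \<open>Cauchy-Schwarz for the inner product defined by \<open>P\<close>, applied to \<open>y\<close> and \<open>P^-1 Q w\<close>
  with \<open>w = S^-1 Q^T y\<close>: both sides of the inequality are inner products of these vectors.\<close>
lemma quadratic_form_projection_le:
  fixes P :: "real^'n^'n" and Q :: "real^'m^'n"
  assumes pd: "pd_mat P" and inj: "\<And>x. Q *v x = 0 \<Longrightarrow> x = 0"
  defines "S \<equiv> transpose Q ** matrix_inv P ** Q"
  shows "(transpose Q *v y) \<bullet> (matrix_inv S *v (transpose Q *v y)) \<le> y \<bullet> (P *v y)"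
proof -
  define z w c where "z = transpose Q *v y" and "w = matrix_inv S *v z"
    and "c = matrix_inv P *v (Q *v w)"
  have pdP': "pd_mat (matrix_inv P)" using pd by (rule pd_mat_matrix_inv)
  have "pd_mat S" unfolding S_def using pdP' inj by (rule pd_mat_congruence)
  then have Sw: "S *v w = z"
    by (simp add: w_def matrix_vector_mul_assoc matrix_inv_inverse pd_mat_invertible)
  have Pc: "P *v c = Q *v w"
    using pd by (simp add: c_def matrix_vector_mul_assoc matrix_mul_assoc matrix_inv_inverse
        pd_mat_invertible)
  have sym_P: "sym_mat P" using pd by (simp add: pd_mat_def)
  have "w \<bullet> z = (Q *v w) \<bullet> y" by (simp add: z_def inner_vector_matrix)
  also have "\<dots> = c \<bullet> (P *v y)" using sym_mat_inner_commute[OF sym_P, of c y] by (simp add: Pc)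
  finally have wz_c: "w \<bullet> z = c \<bullet> (P *v y)" .
  have wz_cc: "w \<bullet> z = c \<bullet> (P *v c)"
  proof -
    have "w \<bullet> z = w \<bullet> (S *v w)" by (simp add: Sw)
    also have "\<dots> = (Q *v w) \<bullet> c"
      by (simp add: S_def c_def inner_vector_matrix flip: matrix_vector_mul_assoc)
    finally show ?thesis by (simp add: Pc inner_commute)
  qed
  have "(w \<bullet> z)\<^sup>2 \<le> (w \<bullet> z) * (y \<bullet> (P *v y))"
    using psd_mat_Cauchy_Schwarz[OF pd_imp_psd_mat[OF pd], of c y] wz_c wz_cc by simp
  moreover have "0 \<le> w \<bullet> z" using pd_imp_psd_mat[OF pd] wz_cc by (simp add: psd_mat_def)
  moreover have "0 \<le> y \<bullet> (P *v y)" using pd_imp_psd_mat[OF pd] by (simp add: psd_mat_def)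
  ultimately have "w \<bullet> z \<le> y \<bullet> (P *v y)"
    by (cases "w \<bullet> z = 0") (simp_all add: power2_eq_square mult_le_cancel_left)
  then show ?thesis by (simp add: z_def w_def inner_commute)
qed

lemma ellipsoid_0_memI:
  fixes S :: "real^'m^'m"
  assumes pd: "pd_mat S" and "z \<bullet> (matrix_inv S *v z) \<le> \<rho>\<^sup>2" and "0 \<le> \<rho>"
  shows "z \<in> ellipsoid 0 S \<rho>"
proof -
  define R w where "R = mat_sqrt S" and "w = matrix_inv S *v z"
  have psdR: "psd_mat R" and RR: "R ** R = S"
    using psd_mat_sqrt[OF pd_imp_psd_mat[OF pd]] by (simp_all add: R_def)
  have Sw: "S *v w = z"
    using pd by (simp add: w_def matrix_vector_mul_assoc matrix_inv_inverse pd_mat_invertible)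
  have "(R *v w) \<bullet> (R *v w) = w \<bullet> z"
    using psdR sym_mat_inner_commute[of R w "R *v w"]
    by (simp add: psd_mat_def matrix_vector_mul_assoc RR Sw)
  with assms(2) have "(norm (R *v w))\<^sup>2 \<le> \<rho>\<^sup>2"
    by (simp add: power2_norm_eq_inner w_def inner_commute)
  then have "norm (R *v w) \<le> \<rho>" using \<open>0 \<le> \<rho>\<close> by (rule power2_le_imp_le)
  moreover have "R *v (R *v w) = z" by (simp add: matrix_vector_mul_assoc RR Sw)
  ultimately show ?thesis unfolding ellipsoid_def R_def by force
qed

lemma lyapunov_quadratic_form:
  fixes A P :: "real^'n^'n" and C :: "real^'n^'r"
  assumes "transpose A ** P + P ** A + transpose C ** C = 0"
  shows "x \<bullet> (P *v (A *v x)) + (A *v x) \<bullet> (P *v x) = - (norm (C *v x))\<^sup>2"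
proof -
  have "0 = x \<bullet> ((transpose A ** P + P ** A + transpose C ** C) *v x)" using assms by simp
  also have "\<dots> = (A *v x) \<bullet> (P *v x) + x \<bullet> (P *v (A *v x)) + (C *v x) \<bullet> (C *v x)"
    by (simp add: matrix_vector_mult_add_rdistrib inner_add_right inner_vector_matrix
        flip: matrix_vector_mul_assoc)
  finally show ?thesis by (simp add: power2_norm_eq_inner)
qed

lemma lyapunov_has_derivative:
  fixes A P :: "real^'n^'n" and C :: "real^'n^'r"
  assumes lyap: "transpose A ** P + P ** A + transpose C ** C = 0"
    and dy: "(y has_vector_derivative (A *v y t)) (at t within T)"
  shows "((\<lambda>s. y s \<bullet> (P *v y s)) has_real_derivative - (norm (C *v y t))\<^sup>2) (at t within T)"
proof -
  have "((\<lambda>s. y s \<bullet> (P *v y s)) has_derivative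
      (*) (y t \<bullet> (P *v (A *v y t)) + (A *v y t) \<bullet> (P *v y t))) (at t within T)"
    using dy unfolding has_vector_derivative_def
    by (auto intro!: derivative_eq_intros
        bounded_linear.has_derivative[OF matrix_vector_mul_bounded_linear] simp: algebra_simps)
  then show ?thesis
    by (simp add: lyapunov_quadratic_form[OF lyap] has_field_derivative_def)
qed

lemma lyapunov_nonincreasing:
  fixes A P :: "real^'n^'n" and C :: "real^'n^'r"
  assumes lyap: "transpose A ** P + P ** A + transpose C ** C = 0"
    and dy: "\<And>t. t \<ge> 0 \<Longrightarrow> (y has_vector_derivative (A *v y t)) (at t within {0..})"
    and "0 \<le> t"
  shows "y t \<bullet> (P *v y t) \<le> y 0 \<bullet> (P *v y 0)"
proof -
  define V where "V s = y s \<bullet> (P *v y s)" for s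
  have dV: "(V has_real_derivative - (norm (C *v y s))\<^sup>2) (at s within {0..})" if "0 \<le> s" for s
    unfolding V_def using lyap dy[OF that] by (rule lyapunov_has_derivative)
  have "continuous_on {0..} V" using dV by (intro DERIV_continuous_on) auto
  then have "continuous_on {0..t} V" by (rule continuous_on_subset) auto
  moreover have "\<exists>D. (V has_real_derivative D) (at s) \<and> D \<le> 0" if "0 < s" for s
    using dV[of s] that at_within_interior[of s "{0..}"] by auto
  ultimately have "V t \<le> V 0" by (intro DERIV_nonpos_imp_decreasing_open[OF \<open>0 \<le> t\<close>]) auto
  then show ?thesis by (simp add: V_def)
qed

theorem proposition13:
  fixes A :: "real^'n^'n" and C :: "real^'n^'r" and P :: "real^'n^'n"
    and Q :: "real^'m^'n" and y :: "real \<Rightarrow> real^'n"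
  assumes "hurwitz A"
    and "observable A C"
    and "pd_mat P"
    and "transpose A ** P + P ** A + transpose C ** C = 0"
    and "transpose Q ** Q = mat 1"
    and "\<And>t. t \<ge> 0 \<Longrightarrow> (y has_vector_derivative (A *v y t)) (at t within {0..})"
  shows "\<forall>t\<ge>0. transpose Q *v y t
           \<in> ellipsoid 0 (transpose Q ** matrix_inv P ** Q) (wnorm P (y 0))"
proof (intro allI impI)
  fix t :: real
  assume "0 \<le> t"
  define S where "S = transpose Q ** matrix_inv P ** Q"
  have inj: "x = 0" if "Q *v x = 0" for x
  proof -
    have "x = (transpose Q ** Q) *v x" using assms(5) by simp
    with that show ?thesis by (simp flip: matrix_vector_mul_assoc)
  qed
  have V0: "0 \<le> y 0 \<bullet> (P *v y 0)"
    using pd_imp_psd_mat[OF assms(3)] unfolding psd_mat_def by blast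
  have "(transpose Q *v y t) \<bullet> (matrix_inv S *v (transpose Q *v y t)) \<le> y t \<bullet> (P *v y t)"
    unfolding S_def using assms(3) inj by (rule quadratic_form_projection_le)
  also have "\<dots> \<le> y 0 \<bullet> (P *v y 0)"
    using assms(4,6) \<open>0 \<le> t\<close> by (rule lyapunov_nonincreasing)
  also have "\<dots> = (wnorm P (y 0))\<^sup>2" using V0 by (simp add: wnorm_def)
  finally have "(transpose Q *v y t) \<bullet> (matrix_inv S *v (transpose Q *v y t)) \<le> (wnorm P (y 0))\<^sup>2" .
  moreover have "pd_mat S"
    unfolding S_def using pd_mat_matrix_inv[OF assms(3)] inj by (rule pd_mat_congruence)
  moreover have "0 \<le> wnorm P (y 0)" using V0 by (simp add: wnorm_def)
  ultimately show "transpose Q *v y t \<in> ellipsoid 0 S (wnorm P (y 0))"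
    by (intro ellipsoid_0_memI)
qed

end
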